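(* Let $d,n\ge 1$ be integers, let $c>0$ be a real number, and let $E_1,\dots,E_n\subset \mathbb{R}^d$ be compact sets with $\operatorname{diam}(E_i)>0$ and $\tau(E_i)\ge c$ for all $1\le i\le n$, where $\tau$ denotes the Feng--Wu thickness. If $$n>\frac{\sqrt d}{(\sqrt{1+c}-1)^2}=\frac{\sqrt d\,(\sqrt{1+c}+1)^2}{c^2},$$ then the Minkowski sum $E_1+\cdots+E_n$ has non-empty interior. In particular (since $0<c\le 1$), the condition $n>6\sqrt d\,c^{-2}$ is sufficient for $E_1+\cdots+E_n$ to have non-empty interior.
   Context: $|\cdot|$ is the Euclidean norm on $\mathbb{R}^d$, and $B(x,r)=\{y\in\mathbb{R}^d:|y-x|\le r\}$ is the closed Euclidean ball. The Minkowski sum of non-empty sets is $E_1+\cdots+E_n=\{x_1+\cdots+x_n: x_i\in E_i\}$. The (Feng--Wu) thickness of a compact set $E\subset\mathbb{R}^d$ is $$\tau(E)=\sup\Bigl\{c\in[0,1]:\ \forall x\in E,\ \forall\,0<r\le \operatorname{diam}(E),\ \exists y\in\mathbb{R}^d\text{ with } B(y,cr)\subset \operatorname{conv}(E\cap B(x,r))\Bigr\},$$ where $\operatorname{conv}$ denotes the convex hull and $\operatorname{diam}$ the diameter. *)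

theory Defs
  imports "HOL-Analysis.Analysis"
begin

text \<open>
  Finite Minkowski sums are sums of sets in the sense of \<^theory>\<open>HOL-Library.Set_Algebras\<close>:
  for finite \<open>I\<close>, \<open>\<Sum>i\<in>I. E i\<close> is the set of all \<open>\<Sum>i\<in>I. x i\<close> with \<open>x i \<in> E i\<close> (\<open>set_sum_alt\<close>).
\<close>

text \<open>
  The set of admissible constants always contains \<open>0\<close> and is bounded by \<open>1\<close>, so the
  conditionally complete \<open>Sup\<close> on \<open>real\<close> is the true supremum.
\<close>

definition thickness :: "'a::euclidean_space set \<Rightarrow> real" where
  "thickness E = Sup {c \<in> {0..1}. \<forall>x\<in>E. \<forall>r. 0 < r \<and> r \<le> diameter E \<longrightarrow>
     (\<exists>y. cball y (c * r) \<subseteq> convex hull (E \<inter> cball x r))}"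

end

theory Submission
  imports Defs
begin

text \<open>
  Call \<open>y\<close> a centre of \<open>E\<close> at scale \<open>r\<close> if the ball of radius \<open>c r\<close> about \<open>y\<close> lies in the convex
  hull of some piece \<open>E \<inter> B(x, r)\<close> with \<open>x \<in> E\<close>. The proof approximates a given point \<open>z\<close> by sums of
  centres \<open>y\<^sub>1 + \<dots> + y\<^sub>n\<close> at scales \<open>r, t r, t\<^sup>2 r, \<dots>\<close>, keeping the error below \<open>n (c - t)\<close> times the
  current scale. Since a centre at scale \<open>r\<close> is within \<open>r\<close> of its set, \<open>z\<close> then has distance \<open>0\<close> from
  the compact set \<open>E\<^sub>1 + \<dots> + E\<^sub>n\<close>. As this works for every \<open>z\<close> that satisfies the error bound at the
  initial scale, the sum contains a ball.

  To pass from scale \<open>r\<close> to scale \<open>t r\<close> (\<open>centers_refine\<close>), note that every point of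
  \<open>E\<^sub>i \<inter> B(x\<^sub>i, r)\<close> is within \<open>t r\<close> of a centre at scale \<open>t r\<close>. Moving the points of a set by at most
  \<open>t r\<close> costs at most \<open>t r\<close> of the radius of a ball in its convex hull, so the convex hull of these
  new centres still contains the ball of radius \<open>(c - t) r\<close> about \<open>y\<^sub>i\<close>
  (\<open>ball_subset_convex_hull_perturbed\<close>). Hence \<open>z\<close>, whose error is below \<open>n (c - t) r\<close>, is a sum of
  points of these \<open>n\<close> convex hulls. The new centres lie in balls of radius \<open>(1 + t) r\<close>, so by the
  Shapley--Folkman--Starr theorem one can choose one from each set with error at most
  \<open>\<surd>d (1 + t) r\<close>. The induction closes if \<open>\<surd>d (1 + t) < n t (c - t)\<close>.

  The quotient \<open>t (c - t) / (1 + t)\<close> is largest at \<open>t = \<surd>(1 + c) - 1\<close>, where it equals \<open>t\<^sup>2\<close>. This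
  explains the bound \<open>n > \<surd>d / (\<surd>(1 + c) - 1)\<^sup>2\<close>. Being strict, it leaves room to replace \<open>c\<close> by a
  slightly smaller constant, so it does not matter whether the supremum that defines the thickness is
  attained.
\<close>

section \<open>The Shapley--Folkman--Starr theorem\<close>

lemma indexed_family_dependent:
  fixes v :: "'i \<Rightarrow> 'a::euclidean_space"
  assumes "finite J" "card J > DIM('a)"
  shows "\<exists>l. (\<exists>i\<in>J. l i \<noteq> 0) \<and> (\<Sum>i\<in>J. l i *\<^sub>R v i) = 0"
proof (cases "inj_on v J")
  case True
  have "dependent (v ` J)"
    by (rule dependent_biggerset) (use assms True in \<open>auto simp: card_image\<close>)
  then obtain u where u: "\<exists>x\<in>v ` J. u x \<noteq> 0" "(\<Sum>x\<in>v ` J. u x *\<^sub>R x) = 0"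
    using assms(1) by (auto simp: dependent_finite)
  have "(\<Sum>i\<in>J. u (v i) *\<^sub>R v i) = 0"
    using u(2) by (simp add: sum.reindex[OF True])
  then show ?thesis using u(1) by (intro exI[of _ "u \<circ> v"]) auto
next
  case False
  then obtain p q where pq: "p \<in> J" "q \<in> J" "p \<noteq> q" "v p = v q"
    by (auto simp: inj_on_def)
  define l :: "'i \<Rightarrow> real" where "l i = (if i = p then 1 else 0) - (if i = q then 1 else 0)" for i
  have "(\<Sum>i\<in>J. l i *\<^sub>R v i) =
      (\<Sum>i\<in>J. (if i = p then v i else 0)) - (\<Sum>i\<in>J. (if i = q then v i else 0))"
    unfolding sum_subtractf[symmetric] by (rule sum.cong) (auto simp: l_def)
  also have "\<dots> = 0" using pq assms(1) by simp
  finally have "(\<Sum>i\<in>J. l i *\<^sub>R v i) = 0" .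
  moreover have "l p \<noteq> 0" using pq by (simp add: l_def)
  ultimately show ?thesis using pq(1) by blast
qed

text \<open>
  Write each \<open>z\<^sub>i\<close> as a convex combination of points of a finite \<open>F\<^sub>i \<subseteq> Y\<^sub>i\<close> and, among all weights
  that give the same total sum, take those with the fewest non-zero entries. An index whose
  combination is not a point of \<open>Y\<^sub>i\<close> has two points \<open>a\<^sub>i \<noteq> b\<^sub>i\<close> of positive weight. If there were more
  than \<open>d\<close> such indices, the vectors \<open>a\<^sub>i - b\<^sub>i\<close> would be linearly dependent, and shifting weight
  between \<open>a\<^sub>i\<close> and \<open>b\<^sub>i\<close> along a dependence would keep the sum and make a further weight vanish.
\<close>

lemma Shapley_Folkman:
  fixes Y :: "'i \<Rightarrow> 'a::euclidean_space set"
  assumes fin: "finite I" and z: "\<And>i. i \<in> I \<Longrightarrow> z i \<in> convex hull (Y i)"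
  shows "\<exists>u. (\<forall>i\<in>I. u i \<in> convex hull (Y i)) \<and> (\<Sum>i\<in>I. u i) = (\<Sum>i\<in>I. z i)
             \<and> card {i\<in>I. u i \<notin> Y i} \<le> DIM('a)"
proof -
  have "\<forall>i\<in>I. \<exists>F w. finite F \<and> F \<subseteq> Y i \<and> (\<forall>y\<in>F. 0 \<le> w y) \<and> sum w F = (1::real)
      \<and> (\<Sum>y\<in>F. w y *\<^sub>R y) = z i"
    using z unfolding convex_hull_explicit by blast
  then obtain F w0 where F: "\<And>i. i \<in> I \<Longrightarrow> finite (F i) \<and> F i \<subseteq> Y i"
    and w0: "\<And>i. i \<in> I \<Longrightarrow> (\<forall>y\<in>F i. 0 \<le> w0 i y) \<and> sum (w0 i) (F i) = (1::real)
      \<and> (\<Sum>y\<in>F i. w0 i y *\<^sub>R y) = z i"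
    unfolding bchoice_iff by blast
  define P where "P w \<longleftrightarrow> (\<forall>i\<in>I. (\<forall>y\<in>F i. 0 \<le> w i y) \<and> sum (w i) (F i) = (1::real))
      \<and> (\<Sum>i\<in>I. \<Sum>y\<in>F i. w i y *\<^sub>R y) = (\<Sum>i\<in>I. z i)" for w
  define N where "N w = (\<Sum>i\<in>I. card {y\<in>F i. w i y \<noteq> (0::real)})" for w
  have "P w0" using w0 by (simp add: P_def)
  then obtain w where Pw: "P w" and least: "\<And>w'. P w' \<Longrightarrow> N w \<le> N w'"
    using ex_has_least_nat[of P w0 N] by auto
  define u where "u i = (\<Sum>y\<in>F i. w i y *\<^sub>R y)" for i
  have wpos: "0 \<le> w i y" if "i \<in> I" "y \<in> F i" for i y using Pw that by (simp add: P_def)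
  have wsum: "sum (w i) (F i) = 1" if "i \<in> I" for i using Pw that by (simp add: P_def)
  have usum: "(\<Sum>i\<in>I. u i) = (\<Sum>i\<in>I. z i)" using Pw by (simp add: P_def u_def)
  have uhull: "u i \<in> convex hull (Y i)" if "i \<in> I" for i
    unfolding convex_hull_explicit u_def using F[OF that] wpos[OF that] wsum[OF that] by blast
  define J where "J = {i\<in>I. u i \<notin> Y i}"
  have finJ: "finite J" and JI: "J \<subseteq> I" using fin by (auto simp: J_def)
  have two: "\<exists>a b. a \<in> F i \<and> b \<in> F i \<and> a \<noteq> b \<and> w i a > 0 \<and> w i b > 0" if "i \<in> J" for i
  proof (rule ccontr)
    assume no: "\<not> ?thesis"
    have iI: "i \<in> I" using that JI by blast
    obtain a where a: "a \<in> F i" "w i a > 0"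
    proof (rule ccontr)
      assume "\<not> thesis"
      then have "\<forall>y\<in>F i. w i y = 0" using wpos[OF iI] that by (metis antisym_conv2 order_le_less)
      then show False using wsum[OF iI] by simp
    qed
    have zero: "w i y = 0" if "y \<in> F i - {a}" for y
      using no a wpos[OF iI, of y] that by (metis DiffE insertI1 order_le_less)
    have "w i a = 1"
      using wsum[OF iI] F[OF iI] a zero by (simp add: sum.remove)
    then have "u i = a"
      unfolding u_def using F[OF iI] a zero by (simp add: sum.remove)
    then show False using that a F[OF iI] by (auto simp: J_def)
  qed
  have "card J \<le> DIM('a)"
  proof (rule ccontr)
    assume "\<not> card J \<le> DIM('a)"
    obtain a0 b0 where ab0: "\<And>i. i \<in> J \<Longrightarrow> a0 i \<in> F i \<and> b0 i \<in> F i \<and> a0 i \<noteq> b0 i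
        \<and> w i (a0 i) > 0 \<and> w i (b0 i) > 0"
      using two by metis
    obtain l where l: "\<exists>i\<in>J. l i \<noteq> 0" "(\<Sum>i\<in>J. l i *\<^sub>R (a0 i - b0 i)) = 0"
      using indexed_family_dependent[OF finJ, of "\<lambda>i. a0 i - b0 i"] \<open>\<not> card J \<le> DIM('a)\<close>
      by auto
    \<comment> \<open>Swapping \<open>a0\<close> and \<open>b0\<close> where the coefficient is negative makes all coefficients non-negative,
      so that weights can only run out at the points \<open>b i\<close>.\<close>
    define a where "a i = (if l i \<ge> 0 then a0 i else b0 i)" for i
    define b where "b i = (if l i \<ge> 0 then b0 i else a0 i)" for i
    define m where "m i = \<bar>l i\<bar>" for i
    have ab: "a i \<in> F i" "b i \<in> F i" "a i \<noteq> b i" "w i (a i) > 0" "w i (b i) > 0" if "i \<in> J" for i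
      using ab0[OF that] by (auto simp: a_def b_def)
    have m0: "(\<Sum>i\<in>J. m i *\<^sub>R (a i - b i)) = 0"
      unfolding l(2)[symmetric]
      by (rule sum.cong) (auto simp: m_def a_def b_def algebra_simps)
    define K where "K = {i\<in>J. m i > 0}"
    have K: "finite K" "K \<noteq> {}" using finJ l(1) by (auto simp: K_def m_def)
    \<comment> \<open>The largest shift that keeps all weights non-negative; it uses up the weight of some \<open>b i0\<close>.\<close>
    define s where "s = Min ((\<lambda>i. w i (b i) / m i) ` K)"
    have "s \<in> (\<lambda>i. w i (b i) / m i) ` K" unfolding s_def using K by (intro Min_in) auto
    then obtain i0 where i0: "i0 \<in> K" "s = w i0 (b i0) / m i0" by auto
    have s0: "s > 0" using i0 ab by (simp add: K_def)
    have sle: "s * m i \<le> w i (b i)" if "i \<in> J" for i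
    proof (cases "i \<in> K")
      case True
      have "s \<le> w i (b i) / m i" unfolding s_def using K True by (intro Min_le) auto
      then show ?thesis using True by (simp add: K_def field_simps)
    next
      case False
      then have "m i = 0" using that by (auto simp: K_def m_def)
      then show ?thesis using ab[OF that] by simp
    qed
    define w' where "w' i y = (if i \<in> J then
        w i y + (if y = a i then s * m i else 0) - (if y = b i then s * m i else 0) else w i y)" for i y
    have sum1: "sum (w' i) (F i) = 1" if "i \<in> I" for i
    proof (cases "i \<in> J")
      case True
      then show ?thesis
        using ab[OF True] F[OF that] wsum[OF that] by (simp add: w'_def sum.distrib sum_subtractf)
    qed (use wsum[OF that] in \<open>simp add: w'_def\<close>)
    have pos': "0 \<le> w' i y" if "i \<in> I" "y \<in> F i" for i y
      using wpos[OF that] sle[of i] ab(3)[of i] s0 by (auto simp: w'_def m_def)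
    have u': "(\<Sum>y\<in>F i. w' i y *\<^sub>R y) = u i + (if i \<in> J then s *\<^sub>R (m i *\<^sub>R (a i - b i)) else 0)"
      if "i \<in> I" for i
    proof (cases "i \<in> J")
      case True
      have "(\<Sum>y\<in>F i. w' i y *\<^sub>R y) = (\<Sum>y\<in>F i. w i y *\<^sub>R y
          + (if y = a i then (s * m i) *\<^sub>R y else 0) - (if y = b i then (s * m i) *\<^sub>R y else 0))"
        using True by (intro sum.cong) (auto simp: w'_def algebra_simps)
      also have "\<dots> = u i + (s * m i) *\<^sub>R a i - (s * m i) *\<^sub>R b i"
        using ab[OF True] F[OF that] by (simp add: sum.distrib sum_subtractf u_def)
      finally show ?thesis using True by (simp add: algebra_simps)
    qed (simp add: w'_def u_def)
    have "(\<Sum>i\<in>I. \<Sum>y\<in>F i. w' i y *\<^sub>R y)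
        = (\<Sum>i\<in>I. u i) + (\<Sum>i\<in>I. if i \<in> J then s *\<^sub>R (m i *\<^sub>R (a i - b i)) else 0)"
      by (simp add: u' sum.distrib)
    also have "(\<Sum>i\<in>I. if i \<in> J then s *\<^sub>R (m i *\<^sub>R (a i - b i)) else 0)
        = (\<Sum>i\<in>J. s *\<^sub>R (m i *\<^sub>R (a i - b i)))"
      using JI fin by (simp add: sum.inter_restrict[symmetric] Int_absorb1)
    also have "\<dots> = 0" by (simp only: scaleR_sum_right[symmetric] m0) simp
    finally have "P w'" using sum1 pos' usum by (simp add: P_def)
    have sub: "{y\<in>F i. w' i y \<noteq> 0} \<subseteq> {y\<in>F i. w i y \<noteq> 0}" for i
      using ab(4,5)[of i] by (auto simp: w'_def split: if_splits)
    have i0J: "i0 \<in> J" "i0 \<in> I" using i0 JI by (auto simp: K_def)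
    have "w' i0 (b i0) = 0"
      using i0 ab(3)[OF i0J(1)] i0J by (auto simp: w'_def K_def)
    then have "{y\<in>F i0. w' i0 y \<noteq> 0} \<subset> {y\<in>F i0. w i0 y \<noteq> 0}"
      using sub[of i0] ab(2,5)[OF i0J(1)] by auto
    then have "card {y\<in>F i0. w' i0 y \<noteq> 0} < card {y\<in>F i0. w i0 y \<noteq> 0}"
      using F[OF i0J(2)] by (intro psubset_card_mono) auto
    moreover have "card {y\<in>F i. w' i y \<noteq> 0} \<le> card {y\<in>F i. w i y \<noteq> 0}" if "i \<in> I" for i
      using F[OF that] sub[of i] by (intro card_mono) auto
    ultimately have "N w' < N w"
      unfolding N_def using fin i0J by (intro sum_strict_mono_ex1) auto
    then show False using least[OF \<open>P w'\<close>] by simp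
  qed
  then show ?thesis using uhull usum unfolding J_def by blast
qed

lemma convex_hull_support_le:
  assumes "z \<in> convex hull Y"
  shows "\<exists>y\<in>Y. inner a z \<le> inner a y"
proof (rule ccontr)
  assume "\<not> ?thesis"
  then have "Y \<subseteq> {y. inner a y < inner a z}" by auto
  then have "convex hull Y \<subseteq> {y. inner a y < inner a z}"
    by (intro hull_minimal) (auto simp: convex_halfspace_lt)
  then show False using assms by auto
qed

text \<open>
  The sets are treated one after the other. If \<open>e\<close> is the error so far, let \<open>e + (u\<^sub>j - x\<^sub>j)\<close> be the error that
  the ball's centre \<open>x\<^sub>j\<close> would leave, and choose \<open>v \<in> Y\<^sub>j\<close> at least as far in that direction as \<open>u\<^sub>j\<close>
  (\<open>convex_hull_support_le\<close>). Expanding the square then shows that the squared error grows by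
  at most \<open>R\<^sup>2\<close>: errors add up like those of independent random choices.
\<close>

lemma greedy_rounding:
  fixes Y :: "'i \<Rightarrow> 'a::real_inner set"
  assumes "finite J" "\<And>i. i \<in> J \<Longrightarrow> u i \<in> convex hull (Y i)" "\<And>i. i \<in> J \<Longrightarrow> Y i \<subseteq> cball (x i) R"
  shows "\<exists>y. (\<forall>i\<in>J. y i \<in> Y i) \<and> (norm (\<Sum>i\<in>J. u i - y i))\<^sup>2 \<le> real (card J) * R\<^sup>2"
  using assms
proof (induction J rule: finite_induct)
  case empty
  then show ?case by simp
next
  case (insert j J)
  then obtain y where y: "\<forall>i\<in>J. y i \<in> Y i"
    and le: "(norm (\<Sum>i\<in>J. u i - y i))\<^sup>2 \<le> real (card J) * R\<^sup>2" by auto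
  define e where "e = (\<Sum>i\<in>J. u i - y i)"
  define p where "p = u j - x j"
  obtain v where v: "v \<in> Y j" "inner (e + p) (u j) \<le> inner (e + p) v"
    using convex_hull_support_le[of "u j" "Y j" "e + p"] insert.prems by auto
  define q where "q = v - x j"
  have q: "norm q \<le> R" using v(1) insert.prems(2)[of j] by (auto simp: q_def dist_norm norm_minus_commute)
  then have qR: "inner q q \<le> R\<^sup>2"
    by (simp add: power2_norm_eq_inner[symmetric] power_mono)
  have pq: "inner (e + p) p \<le> inner (e + p) q"
    using v(2) by (simp add: p_def q_def inner_diff_right)
  have "(norm (e + (u j - v)))\<^sup>2 = inner (e + p - q) (e + p - q)"
    by (simp add: power2_norm_eq_inner p_def q_def algebra_simps)
  also have "\<dots> = inner e e - inner p p + inner q q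
       - 2 * (inner (e + p) q - inner (e + p) p)"
    by (simp add: inner_diff_left inner_diff_right inner_add_left inner_add_right inner_commute)
  also have "\<dots> \<le> inner e e + R\<^sup>2" using qR pq inner_ge_zero[of p] by (smt (verit))
  also have "\<dots> \<le> real (card J) * R\<^sup>2 + R\<^sup>2"
    using le by (simp add: e_def power2_norm_eq_inner)
  finally have fin: "(norm (e + (u j - v)))\<^sup>2 \<le> real (card (insert j J)) * R\<^sup>2"
    using insert.hyps by (simp add: algebra_simps)
  have eq: "(\<Sum>i\<in>insert j J. u i - (y(j := v)) i) = e + (u j - v)"
  proof -
    have "(\<Sum>i\<in>J. u i - (y(j := v)) i) = e"
      unfolding e_def using insert.hyps by (intro sum.cong) auto
    then show ?thesis using insert.hyps by (simp add: add.commute)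
  qed
  show ?case
    by (rule exI[of _ "y(j := v)"]) (use y v fin eq in auto)
qed

text \<open>
  By \<open>Shapley_Folkman\<close> at most \<open>d\<close> summands need rounding, so the error of \<open>greedy_rounding\<close> is
  governed by the dimension and not by the number of sets.
\<close>

lemma Shapley_Folkman_Starr:
  fixes Y :: "'i \<Rightarrow> 'a::euclidean_space set"
  assumes fin: "finite I" and z: "\<And>i. i \<in> I \<Longrightarrow> z i \<in> convex hull (Y i)"
    and Y: "\<And>i. i \<in> I \<Longrightarrow> Y i \<subseteq> cball (x i) R" and "R \<ge> 0"
  shows "\<exists>y. (\<forall>i\<in>I. y i \<in> Y i) \<and> norm ((\<Sum>i\<in>I. z i) - (\<Sum>i\<in>I. y i)) \<le> sqrt (DIM('a)) * R"
proof -
  obtain u where u: "\<forall>i\<in>I. u i \<in> convex hull (Y i)" "(\<Sum>i\<in>I. u i) = (\<Sum>i\<in>I. z i)"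
      "card {i\<in>I. u i \<notin> Y i} \<le> DIM('a)"
    using Shapley_Folkman[of I z Y] fin z by blast
  define J where "J = {i\<in>I. u i \<notin> Y i}"
  obtain y where y: "\<forall>i\<in>J. y i \<in> Y i" "(norm (\<Sum>i\<in>J. u i - y i))\<^sup>2 \<le> real (card J) * R\<^sup>2"
    using greedy_rounding[of J u Y x R] fin u(1) Y by (auto simp: J_def)
  define y' where "y' i = (if i \<in> J then y i else u i)" for i
  have "(\<Sum>i\<in>I. z i) - (\<Sum>i\<in>I. y' i) = (\<Sum>i\<in>I. u i - y' i)"
    by (simp add: u(2)[symmetric] sum_subtractf)
  also have "\<dots> = (\<Sum>i\<in>J. u i - y i)"
    by (rule sum.mono_neutral_cong_right) (use fin in \<open>auto simp: J_def y'_def\<close>)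
  finally have "(norm ((\<Sum>i\<in>I. z i) - (\<Sum>i\<in>I. y' i)))\<^sup>2 \<le> real (card J) * R\<^sup>2" using y(2) by simp
  also have "\<dots> \<le> real DIM('a) * R\<^sup>2"
    using u(3) by (intro mult_right_mono) (auto simp: J_def)
  also have "\<dots> = (sqrt (DIM('a)) * R)\<^sup>2" by (simp add: power_mult_distrib)
  finally have "norm ((\<Sum>i\<in>I. z i) - (\<Sum>i\<in>I. y' i)) \<le> sqrt (DIM('a)) * R"
    by (rule power2_le_imp_le) (use \<open>R \<ge> 0\<close> in simp)
  moreover have "\<forall>i\<in>I. y' i \<in> Y i" using y(1) by (auto simp: y'_def J_def)
  ultimately show ?thesis by blast
qed

section \<open>Refining centres from one scale to the next\<close>

text \<open>
  If a hyperplane with normal \<open>a\<close> separated \<open>q\<close> from the hull of \<open>Y\<close>, then moving \<open>q\<close> by \<open>\<delta>\<close> away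
  from \<open>Y\<close> would give a point that is still in the hull of \<open>A\<close>, although every point of \<open>A\<close> reaches
  less than \<open>\<delta>\<close> beyond \<open>q\<close> in that direction. Separation needs a closed set, and the
  hull of \<open>Y\<close> need not be closed, so this puts the ball into the closure of the hull; an open ball
  is then inside the hull itself, because a convex set and its closure have the same interior.
\<close>

lemma ball_subset_convex_hull_perturbed:
  fixes A Y :: "'a::euclidean_space set"
  assumes sub: "cball p \<rho> \<subseteq> convex hull A" and near: "\<And>x. x \<in> A \<Longrightarrow> \<exists>y\<in>Y. dist x y \<le> \<delta>"
    and "0 \<le> \<delta>"
  shows "ball p (\<rho> - \<delta>) \<subseteq> convex hull Y"
proof -
  let ?C = "closure (convex hull Y)"
  have "ball p (\<rho> - \<delta>) \<subseteq> ?C"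
  proof
    fix q assume q: "q \<in> ball p (\<rho> - \<delta>)"
    show "q \<in> ?C"
    proof (rule ccontr)
      assume "q \<notin> ?C"
      then obtain a b where ab: "inner a q < b" "\<And>x. x \<in> ?C \<Longrightarrow> b < inner a x"
        using separating_hyperplane_closed_point[OF convex_closure[OF convex_convex_hull] closed_closure]
        by blast
      have "a \<noteq> 0"
      proof
        assume "a = 0"
        have "dist p q < \<rho> - \<delta>" using q by simp
        then have "0 \<le> \<rho>" using \<open>0 \<le> \<delta>\<close> zero_le_dist[of p q] by linarith
        then have "p \<in> convex hull A" using sub by auto
        then have "A \<noteq> {}" by auto
        then obtain y where "y \<in> Y" using near by blast
        then have "y \<in> ?C" by (meson closure_subset hull_inc subset_eq)
        then show False using ab \<open>a = 0\<close> by fastforce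
      qed
      define q' where "q' = q - (\<delta> / norm a) *\<^sub>R a"
      have "dist q q' = \<delta>" using \<open>a \<noteq> 0\<close> \<open>0 \<le> \<delta>\<close> by (simp add: q'_def dist_norm)
      then have "q' \<in> cball p \<rho>" using q dist_triangle[of p q' q] by auto
      then have "q' \<in> convex hull A" using sub by blast
      then obtain x where x: "x \<in> A" "inner (- a) q' \<le> inner (- a) x"
        using convex_hull_support_le by blast
      obtain y where y: "y \<in> Y" "dist x y \<le> \<delta>" using near[OF x(1)] by blast
      then have "y \<in> ?C" by (meson closure_subset hull_inc subset_eq)
      then have "inner a q < inner a y" using ab by fastforce
      also have "inner a y = inner a x + inner a (y - x)" by (simp add: inner_diff_right)
      also have "inner a (y - x) \<le> norm a * \<delta>"
        using norm_cauchy_schwarz[of a "y - x"] y(2)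
        by (smt (verit) dist_norm dist_commute mult_left_mono norm_ge_zero)
      also have "inner a x \<le> inner a q'" using x(2) by simp
      also have "inner a q' = inner a q - \<delta> * norm a"
        using \<open>a \<noteq> 0\<close> by (simp add: q'_def inner_diff_right power2_norm_eq_inner[symmetric] power2_eq_square)
      finally show False by (simp add: algebra_simps)
    qed
  qed
  then have "ball p (\<rho> - \<delta>) \<subseteq> interior ?C" by (simp add: interior_maximal)
  also have "\<dots> = interior (convex hull Y)" by (intro convex_interior_closure convex_convex_hull)
  also have "\<dots> \<subseteq> convex hull Y" by (rule interior_subset)
  finally show ?thesis .
qed

text \<open>
  The scale \<open>r\<close> is a parameter and the point \<open>x\<close> is hidden: the iteration only keeps track of the
  points \<open>y\<close>, and \<open>x\<close> is recovered when it is needed.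
\<close>

definition centers :: "real \<Rightarrow> 'a::euclidean_space set \<Rightarrow> real \<Rightarrow> 'a set" where
  "centers c E r = {y. \<exists>x\<in>E. cball y (c * r) \<subseteq> convex hull (E \<inter> cball x r)}"

lemma center_dist_le_scale:
  fixes E :: "'a::euclidean_space set"
  assumes "cball y (c * r) \<subseteq> convex hull (E \<inter> cball x r)" "0 \<le> c" "0 \<le> r"
  shows "dist x y \<le> r"
proof -
  have "y \<in> convex hull (E \<inter> cball x r)" using assms by auto
  also have "\<dots> \<subseteq> cball x r" by (intro hull_minimal) auto
  finally show ?thesis by simp
qed

text \<open>
  This is the inductive step. The deviation of \<open>z\<close> from the sum of the old centres is shared equally
  among the sets, which moves each old centre by less than \<open>(c - t) r\<close> and so keeps it inside the
  hull of the new centres near it.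
\<close>

lemma centers_refine:
  fixes E :: "'i \<Rightarrow> 'a::euclidean_space set"
  assumes I: "finite I" "I \<noteq> {}" and "0 < t" "t < c" "0 < r"
    and n: "sqrt DIM('a) * (1 + t) < real (card I) * (t * (c - t))"
    and thick: "\<And>i x. i \<in> I \<Longrightarrow> x \<in> E i \<Longrightarrow> \<exists>y. cball y (c * (t * r)) \<subseteq> convex hull (E i \<inter> cball x (t * r))"
    and y: "\<And>i. i \<in> I \<Longrightarrow> y i \<in> centers c (E i) r"
    and z: "dist z (\<Sum>i\<in>I. y i) < real (card I) * ((c - t) * r)"
  shows "\<exists>y'. (\<forall>i\<in>I. y' i \<in> centers c (E i) (t * r))
              \<and> dist z (\<Sum>i\<in>I. y' i) < real (card I) * ((c - t) * (t * r))"
proof -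
  obtain x where x: "\<And>i. i \<in> I \<Longrightarrow> x i \<in> E i"
    "\<And>i. i \<in> I \<Longrightarrow> cball (y i) (c * r) \<subseteq> convex hull (E i \<inter> cball (x i) r)"
    using y unfolding centers_def by simp metis
  define Y where "Y i = centers c (E i) (t * r) \<inter> cball (x i) ((1 + t) * r)" for i
  have tr: "0 < t * r" "0 < c" using assms by auto
  have "ball (y i) (c * r - t * r) \<subseteq> convex hull (Y i)" if iI: "i \<in> I" for i
  proof (rule ball_subset_convex_hull_perturbed[OF x(2)[OF iI]])
    fix p assume p: "p \<in> E i \<inter> cball (x i) r"
    obtain q where q: "cball q (c * (t * r)) \<subseteq> convex hull (E i \<inter> cball p (t * r))"
      using thick[OF iI, of p] p by blast
    have d: "dist p q \<le> t * r" using center_dist_le_scale[OF q] tr by simp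
    have "q \<in> Y i"
      using p q d dist_triangle[of "x i" q p] by (auto simp: Y_def centers_def algebra_simps)
    then show "\<exists>q\<in>Y i. dist p q \<le> t * r" using d by blast
  qed (use tr in simp)
  note balls = this
  define m where "m = real (card I)"
  have m: "m > 0" using I by (simp add: m_def card_gt_0_iff)
  define s where "s = (\<Sum>i\<in>I. y i)"
  define u where "u i = y i + (1 / m) *\<^sub>R (z - s)" for i
  have usum: "(\<Sum>i\<in>I. u i) = z"
    using m by (simp add: u_def sum.distrib s_def[symmetric] sum_constant_scaleR m_def)
  have "norm (z - s) / m < (c - t) * r"
    using z m by (simp add: s_def m_def dist_norm field_simps)
  then have "u i \<in> ball (y i) (c * r - t * r)" for i
    using m by (simp add: u_def dist_norm left_diff_distrib)
  then have "u i \<in> convex hull (Y i)" if "i \<in> I" for i using balls[OF that] by blast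
  then obtain y' where y': "\<forall>i\<in>I. y' i \<in> Y i"
      "norm ((\<Sum>i\<in>I. u i) - (\<Sum>i\<in>I. y' i)) \<le> sqrt DIM('a) * ((1 + t) * r)"
    using Shapley_Folkman_Starr[of I u Y x "(1 + t) * r"] I assms(3,5) unfolding Y_def by auto
  have "dist z (\<Sum>i\<in>I. y' i) \<le> (sqrt DIM('a) * (1 + t)) * r"
    using y'(2) by (simp add: usum dist_norm algebra_simps)
  also have "\<dots> < (real (card I) * (t * (c - t))) * r"
    using n \<open>0 < r\<close> by (rule mult_strict_right_mono)
  finally show ?thesis using y'(1) unfolding Y_def by (intro exI[of _ y']) (auto simp: algebra_simps)
qed

lemma compact_set_sum:
  fixes E :: "'i \<Rightarrow> 'a::real_normed_vector set"
  assumes "finite I" "\<And>i. i \<in> I \<Longrightarrow> compact (E i)"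
  shows "compact (\<Sum>i\<in>I. E i)"
  using assms
proof (induction I rule: finite_induct)
  case (insert j I)
  have "E j + (\<Sum>i\<in>I. E i) = {x + y |x y. x \<in> E j \<and> y \<in> (\<Sum>i\<in>I. E i)}"
    by (auto simp: set_plus_def)
  then show ?case using insert compact_sums[of "E j" "\<Sum>i\<in>I. E i"] by simp
qed (simp add: set_zero)

section \<open>Sums of thick sets\<close>

lemma interior_sum_nonempty:
  fixes E :: "'i \<Rightarrow> 'a::euclidean_space set"
  assumes I: "finite I" "I \<noteq> {}" and t: "0 < t" "t < c" "t < 1" and "0 < r"
    and n: "sqrt DIM('a) * (1 + t) < real (card I) * (t * (c - t))"
    and E: "\<And>i. i \<in> I \<Longrightarrow> compact (E i)" "\<And>i. i \<in> I \<Longrightarrow> E i \<noteq> {}"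
    and thick: "\<And>i x s. i \<in> I \<Longrightarrow> x \<in> E i \<Longrightarrow> 0 < s \<Longrightarrow> s \<le> r \<Longrightarrow>
        \<exists>y. cball y (c * s) \<subseteq> convex hull (E i \<inter> cball x s)"
  shows "interior (\<Sum>i\<in>I. E i) \<noteq> {}"
proof -
  let ?S = "\<Sum>i\<in>I. E i"
  define m where "m = real (card I)"
  have m: "m > 0" using I by (simp add: m_def card_gt_0_iff)
  have "\<exists>y. y \<in> centers c (E i) r" if "i \<in> I" for i
    using E(2)[OF that] thick[OF that _ \<open>0 < r\<close>] unfolding centers_def by blast
  then obtain y0 where y0: "\<And>i. i \<in> I \<Longrightarrow> y0 i \<in> centers c (E i) r" by metis
  have "ball (\<Sum>i\<in>I. y0 i) (m * ((c - t) * r)) \<subseteq> ?S"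
  proof
    fix z assume "z \<in> ball (\<Sum>i\<in>I. y0 i) (m * ((c - t) * r))"
    then have z: "dist z (\<Sum>i\<in>I. y0 i) < m * ((c - t) * r)" by (simp add: dist_commute)
    \<comment> \<open>Distances to the sums of centres shrink geometrically along the scales \<open>t ^ k * r\<close>.\<close>
    have scale: "\<exists>y. (\<forall>i\<in>I. y i \<in> centers c (E i) (t ^ k * r))
        \<and> dist z (\<Sum>i\<in>I. y i) < m * ((c - t) * (t ^ k * r))" for k
    proof (induction k)
      case 0
      then show ?case using y0 z by auto
    next
      case (Suc k)
      then obtain y where y: "\<forall>i\<in>I. y i \<in> centers c (E i) (t ^ k * r)"
        "dist z (\<Sum>i\<in>I. y i) < m * ((c - t) * (t ^ k * r))" by blast
      have small: "t * (t ^ k * r) \<le> r"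
        using power_le_one[of t "Suc k"] t \<open>0 < r\<close> mult_right_mono[of "t ^ Suc k" 1 r] 
        by (simp add: mult.assoc)
      have pos: "0 < t * (t ^ k * r)" using t \<open>0 < r\<close> by simp
      have "\<exists>y'. (\<forall>i\<in>I. y' i \<in> centers c (E i) (t * (t ^ k * r)))
              \<and> dist z (\<Sum>i\<in>I. y' i) < real (card I) * ((c - t) * (t * (t ^ k * r)))"
        by (rule centers_refine[OF I t(1,2) _ n, of "t ^ k * r" E y z])
           (use t \<open>0 < r\<close> y thick small pos in \<open>auto simp: m_def\<close>)
      then show ?case by (simp add: m_def mult.assoc)
    qed
    \<comment> \<open>Replacing each centre by the point of \<open>E i\<close> that it belongs to costs at most the scale itself.\<close>
    have approx: "\<exists>s\<in>?S. dist s z < (m * (c - t) + m) * r * t ^ k" for k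
    proof -
      obtain y where y: "\<And>i. i \<in> I \<Longrightarrow> y i \<in> centers c (E i) (t ^ k * r)"
        "dist z (\<Sum>i\<in>I. y i) < m * ((c - t) * (t ^ k * r))" using scale by blast
      obtain x where x: "\<And>i. i \<in> I \<Longrightarrow> x i \<in> E i \<and> 
          cball (y i) (c * (t ^ k * r)) \<subseteq> convex hull (E i \<inter> cball (x i) (t ^ k * r))"
        using y(1) unfolding centers_def by simp metis
      have "dist (x i) (y i) \<le> t ^ k * r" if "i \<in> I" for i
        by (rule center_dist_le_scale[of _ c]) (use x[OF that] t \<open>0 < r\<close> in auto)
      then have "dist (\<Sum>i\<in>I. x i) (\<Sum>i\<in>I. y i) \<le> (\<Sum>i\<in>I. t ^ k * r)"
        unfolding dist_norm sum_subtractf[symmetric] by (intro sum_norm_le)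
      also have "\<dots> = m * (t ^ k * r)" by (simp add: m_def)
      finally have "dist (\<Sum>i\<in>I. x i) z < m * ((c - t) * (t ^ k * r)) + m * (t ^ k * r)"
        using y(2) dist_triangle[of "\<Sum>i\<in>I. x i" z "\<Sum>i\<in>I. y i"] by (simp add: dist_commute)
      moreover have "(\<Sum>i\<in>I. x i) \<in> ?S" using x I by (auto simp: set_sum_alt)
      ultimately show ?thesis by (intro bexI) (auto simp: algebra_simps)
    qed
    have "(\<lambda>k. (m * (c - t) + m) * r * t ^ k) \<longlonglongrightarrow> (m * (c - t) + m) * r * 0"
      using t by (intro tendsto_mult tendsto_const LIMSEQ_power_zero) auto
    then have lim: "(\<lambda>k. (m * (c - t) + m) * r * t ^ k) \<longlonglongrightarrow> 0" by simp
    have "z \<in> closure ?S"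
      unfolding closure_approachable
    proof (intro allI impI)
      fix e :: real assume "0 < e"
      then have "\<forall>\<^sub>F k in sequentially. (m * (c - t) + m) * r * t ^ k < e"
        using lim by (rule order_tendstoD(2)[rotated])
      then obtain k where "(m * (c - t) + m) * r * t ^ k < e"
        by (auto simp: eventually_sequentially)
      then show "\<exists>s\<in>?S. dist s z < e" using approx[of k] by force
    qed
    moreover have "closed ?S" using compact_set_sum[of I E] I E(1) compact_imp_closed by blast
    ultimately show "z \<in> ?S" by simp
  qed
  then have "ball (\<Sum>i\<in>I. y0 i) (m * ((c - t) * r)) \<subseteq> interior ?S" by (simp add: interior_maximal)
  moreover have "(\<Sum>i\<in>I. y0 i) \<in> ball (\<Sum>i\<in>I. y0 i) (m * ((c - t) * r))"
    using m t \<open>0 < r\<close> by simp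
  ultimately show ?thesis by blast
qed

lemma admissible_constants:
  fixes E :: "'a::euclidean_space set"
  defines "T \<equiv> {c \<in> {0..1}. \<forall>x\<in>E. \<forall>r. 0 < r \<and> r \<le> diameter E \<longrightarrow>
     (\<exists>y. cball y (c * r) \<subseteq> convex hull (E \<inter> cball x r))}"
  shows "0 \<in> T" and "bdd_above T"
proof -
  show "bdd_above T" by (rule bdd_aboveI[of _ 1]) (auto simp: T_def)
  have "cball x (0 * r) \<subseteq> convex hull (E \<inter> cball x r)" if "x \<in> E" "0 < r" for x r
    using that by (auto intro: hull_inc)
  then show "0 \<in> T" unfolding T_def by auto
qed

lemma thickness_le_1: "thickness E \<le> 1"
  unfolding thickness_def
proof (rule cSup_least)
  show "{c \<in> {0..1}. \<forall>x\<in>E. \<forall>r. 0 < r \<and> r \<le> diameter E \<longrightarrow>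
     (\<exists>y. cball y (c * r) \<subseteq> convex hull (E \<inter> cball x r))} \<noteq> {}"
    using admissible_constants(1)[of E] by blast
qed auto

text \<open>
  The admissible constants form a down-set because balls shrink with their radius, so every constant
  strictly below the supremum is admissible.
\<close>

lemma thickness_gtD:
  fixes E :: "'a::euclidean_space set"
  assumes "c < thickness E" "x \<in> E" "0 < r" "r \<le> diameter E"
  shows "\<exists>y. cball y (c * r) \<subseteq> convex hull (E \<inter> cball x r)"
proof -
  obtain c' where "c < c'" "\<exists>y. cball y (c' * r) \<subseteq> convex hull (E \<inter> cball x r)"
    using assms(1) less_cSup_iff[OF _ admissible_constants(2)[of E], of c] admissible_constants(1)[of E] assms(2-)
    unfolding thickness_def by blast
  moreover have "cball y (c * r) \<subseteq> cball y (c' * r)" for y :: 'a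
    using \<open>c < c'\<close> \<open>0 < r\<close> by (intro subset_cball mult_right_mono) auto
  ultimately show ?thesis by (meson subset_trans)
qed

text \<open>
  The number \<open>t\<close> maximises \<open>t (c - t) / (1 + t)\<close>; it is the positive root of \<open>t\<^sup>2 + 2 t = c\<close>. By
  \<open>thickness_gtD\<close> every \<open>c' < c\<close> is admissible for all the sets. The threshold \<open>b\<close> is the
  value of \<open>c'\<close> at which \<open>\<surd>d (1 + t) = n t (c' - t)\<close>, and the hypothesis on \<open>n\<close> says that
  \<open>b < c\<close>.
\<close>

lemma interior_sum_of_thick_sets:
  fixes E :: "'i \<Rightarrow> 'a::euclidean_space set"
  assumes I: "finite I" "I \<noteq> {}" and "c > 0"
    and E: "\<And>i. i \<in> I \<Longrightarrow> compact (E i)" "\<And>i. i \<in> I \<Longrightarrow> diameter (E i) > 0"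
      "\<And>i. i \<in> I \<Longrightarrow> thickness (E i) \<ge> c"
    and n: "real (card I) > sqrt DIM('a) / (sqrt (1 + c) - 1)\<^sup>2"
  shows "interior (\<Sum>i\<in>I. E i) \<noteq> {}"
proof -
  define t where "t = sqrt (1 + c) - 1"
  have t0: "t > 0" using \<open>c > 0\<close> by (simp add: t_def)
  have ct: "c = t\<^sup>2 + 2 * t" using \<open>c > 0\<close> by (simp add: t_def power2_diff)
  define m where "m = real (card I)"
  have m: "m > 0" using I by (simp add: m_def card_gt_0_iff)
  define b where "b = t + sqrt DIM('a) * (1 + t) / (m * t)"
  have "sqrt DIM('a) < m * t\<^sup>2" using n t0 by (simp add: t_def[symmetric] m_def field_simps)
  then have "sqrt DIM('a) * (1 + t) < (m * t\<^sup>2) * (1 + t)" using t0 by simp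
  then have "sqrt DIM('a) * (1 + t) / (m * t) < t * (1 + t)"
    using t0 m by (simp add: field_simps power2_eq_square)
  then have "b < c" by (simp add: b_def ct power2_eq_square algebra_simps)
  then obtain c' where c': "b < c'" "c' < c" using dense by blast
  have "t < b" using t0 m by (simp add: b_def add_pos_pos)
  then have tc: "t < c'" using c' by simp
  have "sqrt DIM('a) * (1 + t) / (m * t) < c' - t" using c' by (simp add: b_def)
  then have cond: "sqrt DIM('a) * (1 + t) < m * (t * (c' - t))"
    using t0 m by (simp add: field_simps)
  have "c \<le> 1" using I E(3) thickness_le_1 order_trans by blast
  then have t1: "t < 1" using c' tc by simp
  define r where "r = Min ((\<lambda>i. diameter (E i)) ` I)"
  have r: "r > 0" using I E(2) by (simp add: r_def)
  have rle: "r \<le> diameter (E i)" if "i \<in> I" for i using I that by (simp add: r_def)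
  have ne: "E i \<noteq> {}" if "i \<in> I" for i using E(2)[OF that] by auto
  show ?thesis
  proof (rule interior_sum_nonempty[OF I t0 tc t1 r cond[unfolded m_def] E(1) ne])
    fix i x s assume "i \<in> I" "x \<in> E i" "0 < s" "s \<le> r"
    then show "\<exists>y. cball y (c' * s) \<subseteq> convex hull (E i \<inter> cball x s)"
      using thickness_gtD[of c' "E i" x s] E(3)[of i] c' rle[of i] by simp
  qed
qed

theorem theorem1:
  fixes E :: "nat \<Rightarrow> (real ^ 'd) set"
    and n :: nat
    and c :: real
  assumes "n \<ge> 1"
    and "c > 0"
    and "\<And>i. i \<in> {1..n} \<Longrightarrow> compact (E i)"
    and "\<And>i. i \<in> {1..n} \<Longrightarrow> diameter (E i) > 0"
    and "\<And>i. i \<in> {1..n} \<Longrightarrow> thickness (E i) \<ge> c"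
  shows "sqrt (real CARD('d)) / (sqrt (1 + c) - 1)^2
           = sqrt (real CARD('d)) * (sqrt (1 + c) + 1)^2 / c^2
    \<and> (real n > sqrt (real CARD('d)) / (sqrt (1 + c) - 1)^2
           \<longrightarrow> interior (\<Sum>i=1..n. E i) \<noteq> {})
    \<and> c \<le> 1
    \<and> (real n > 6 * sqrt (real CARD('d)) / c^2
           \<longrightarrow> interior (\<Sum>i=1..n. E i) \<noteq> {})"
proof -
  let ?d = "sqrt (real CARD('d))"
  have c1: "c \<le> 1" using assms(5)[of 1] assms(1) thickness_le_1[of "E 1"] by simp
  define q where "q = sqrt (1 + c)"
  have q: "q > 1" "q\<^sup>2 = 1 + c" using assms(2) by (auto simp: q_def)
  have "(q - 1) * (q + 1) = c" using q(2) by (simp add: power2_eq_square algebra_simps)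
  then have "c\<^sup>2 = (q - 1)\<^sup>2 * (q + 1)\<^sup>2" by (metis power_mult_distrib)
  then have eq: "?d / (q - 1)\<^sup>2 = ?d * (q + 1)\<^sup>2 / c\<^sup>2" using q(1) by simp
  have main: "interior (\<Sum>i=1..n. E i) \<noteq> {}" if "real n > ?d / (q - 1)\<^sup>2"
    by (rule interior_sum_of_thick_sets[of _ c]) (use assms that in \<open>auto simp: q_def\<close>)
  \<comment> \<open>\<open>c \<le> 1\<close> gives \<open>(q + 1)\<^sup>2 \<le> (\<surd>2 + 1)\<^sup>2 = 3 + 2 \<surd>2 < 6\<close>; any rational bound on \<open>\<surd>2\<close> below
    \<open>\<surd>6 - 1\<close> suffices.\<close>
  have "q \<le> 143 / 100" using c1 unfolding q_def by (intro real_le_lsqrt) (auto simp: power2_eq_square)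
  then have "(q + 1)\<^sup>2 \<le> 6" using q(1) power_mono[of "q + 1" "243 / 100" 2] by (simp add: power2_eq_square)
  then have "?d * (q + 1)\<^sup>2 / c\<^sup>2 \<le> 6 * ?d / c\<^sup>2"
    by (intro divide_right_mono) (auto simp: mult.commute mult_left_mono)
  then have "?d / (q - 1)\<^sup>2 \<le> 6 * ?d / c\<^sup>2" using eq by simp
  then show ?thesis using eq main c1 unfolding q_def by auto
qed

end
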